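(* Let $W$ be a weighing matrix $W(23,16)$. Then $\widetilde\Gamma(W)$ is a regular weighted graph of degree $10$; that is, for every vertex $i\in\{1,\ldots,23\}$, the sum of the weights of all edges of $\widetilde\Gamma(W)$ incident to $i$ equals $10$.
   Context: A weighing matrix $W(n,k)$ is an $n\times n$ matrix $W$ with entries in $\{0,1,-1\}$ whose rows are pairwise orthogonal and have length $\sqrt{k}$, i.e. $WW^T=kI_n$. For a weighing matrix $W$ of type $W(23,16)$ and $i\in\{1,\ldots,23\}$, let $L_i\subseteq\{1,\ldots,23\}$ (the $i$-th "line") be the set of column positions at which the $i$-th row of $W$ is zero. The weighted graph $\widetilde\Gamma(W)$ has vertex set $\{1,2,\ldots,23\}$, and distinct vertices $i$ and $j$ are joined by an edge of weight $1$, $2$, $3$ if $|L_i\cap L_j|=3,5,7$ respectively (and are not joined otherwise); there are no loops. *)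

theory Defs
  imports "Jordan_Normal_Form.Matrix"
begin

definition weighing_matrix :: "nat \<Rightarrow> nat \<Rightarrow> int mat \<Rightarrow> bool" where
  "weighing_matrix n k W \<longleftrightarrow>
     W \<in> carrier_mat n n \<and> elements_mat W \<subseteq> {0, 1, -1} \<and>
     W * transpose_mat W = int k \<cdot>\<^sub>m 1\<^sub>m n"

text \<open>
  Simple undirected graphs with weighted edges. An edge is the two-element set of its endpoints;
  the value of \<open>weight\<close> on a set that is not an edge is irrelevant.
\<close>

record 'a wgraph =
  verts :: "'a set"
  edges :: "'a set set"
  weight :: "'a set \<Rightarrow> nat"

definition weighted_graph :: "'a wgraph \<Rightarrow> bool" where
  "weighted_graph G \<longleftrightarrow>
     finite (verts G) \<and>
     (\<forall>e \<in> edges G. e \<subseteq> verts G \<and> card e = 2 \<and> weight G e > 0)"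

definition wdegree :: "'a wgraph \<Rightarrow> 'a \<Rightarrow> nat" where
  "wdegree G v = (\<Sum>e \<in> {e \<in> edges G. v \<in> e}. weight G e)"

definition regular_weighted_graph :: "'a wgraph \<Rightarrow> nat \<Rightarrow> bool" where
  "regular_weighted_graph G d \<longleftrightarrow> weighted_graph G \<and> (\<forall>v \<in> verts G. wdegree G v = d)"

text \<open>
  Rows and columns of matrices are numbered from \<open>0\<close>, so the lines and the vertices of the graph
  are indexed by \<open>0, \<dots>, n - 1\<close> instead of \<open>1, \<dots>, n\<close>.
\<close>

definition line :: "int mat \<Rightarrow> nat \<Rightarrow> nat set" where
  "line W i = {j. j < dim_col W \<and> W $$ (i, j) = 0}"

text \<open>For an edge \<open>e = {i, j}\<close>, the intersection over \<open>e\<close> below is \<open>line W i \<inter> line W j\<close>.\<close>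

definition Gamma_tilde :: "int mat \<Rightarrow> nat wgraph" where
  "Gamma_tilde W =
     \<lparr> verts = {..<dim_row W},
       edges = {{i, j} | i j. i < dim_row W \<and> j < dim_row W \<and> i \<noteq> j \<and>
                              card (line W i \<inter> line W j) \<in> {3, 5, 7}},
       weight = (\<lambda>e. let c = card (\<Inter>i\<in>e. line W i) in
                     if c = 3 then 1 else if c = 5 then 2 else if c = 7 then 3 else 0) \<rparr>"

end

theory Submission
  imports Defs "Jordan_Normal_Form.Determinant"
begin

text \<open>
  Since \<open>W\<close> is invertible, its columns are also orthogonal, so that every point lies on
  \<open>n - k = 7\<close> lines, and every line has \<open>7\<close> points. Counting the incidences on a line \<open>L\<^sub>i\<close> gives
  \<open>\<Sum>j\<noteq>i. |L\<^sub>i \<inter> L\<^sub>j| = 7 * 6 = 42\<close>. Orthogonality of two rows modulo \<open>2\<close> makes every \<open>|L\<^sub>i \<inter> L\<^sub>j|\<close>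
  odd, so it is one of \<open>1, 3, 5, 7\<close>, and the weight of \<open>{i, j}\<close> is \<open>(|L\<^sub>i \<inter> L\<^sub>j| - 1) / 2\<close> (reading a
  missing edge as weight \<open>0\<close>). The degree is therefore \<open>(42 - 22) / 2 = 10\<close>.
\<close>

text \<open>Dividing by \<open>k\<close> takes place over the rationals: there the scaled transpose
  is a right inverse of a square matrix, hence also a left inverse. Injectivity of the embedding of
  the integers carries the identity back.\<close>

lemma weighing_matrix_transpose_mult:
  assumes W: "weighing_matrix n k W" and k: "k \<noteq> 0"
  shows "transpose_mat W * W = int k \<cdot>\<^sub>m 1\<^sub>m n"
proof -
  have C: "W \<in> carrier_mat n n" and WW: "W * transpose_mat W = int k \<cdot>\<^sub>m 1\<^sub>m n"
    using W by (auto simp: weighing_matrix_def)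
  define V :: "rat mat" where "V = map_mat of_int W"
  have V: "V \<in> carrier_mat n n" using C by (simp add: V_def)
  have VT: "transpose_mat V = map_mat of_int (transpose_mat W)"
    by (auto simp: V_def)
  have "V * transpose_mat V = map_mat of_int (W * transpose_mat W)"
    unfolding VT unfolding V_def using C by (subst of_int_hom.mat_hom_mult[of _ n n _ n]) auto
  also have "\<dots> = of_nat k \<cdot>\<^sub>m 1\<^sub>m n" unfolding WW by (intro eq_matI) auto
  finally have VV: "V * transpose_mat V = of_nat k \<cdot>\<^sub>m 1\<^sub>m n" .
  have "V * ((1 / of_nat k) \<cdot>\<^sub>m transpose_mat V) = 1\<^sub>m n"
    using V k by (auto simp: mult_smult_distrib[of _ n n _ n] VV intro!: eq_matI)
  hence "((1 / of_nat k) \<cdot>\<^sub>m transpose_mat V) * V = 1\<^sub>m n"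
    by (rule mat_mult_left_right_inverse[rotated 2]) (use V in simp_all)
  hence "(1 / of_nat k) \<cdot>\<^sub>m (transpose_mat V * V) = 1\<^sub>m n"
    using V mult_smult_assoc_mat[of "transpose_mat V" n n V n "1 / of_nat k"] by simp
  moreover have "of_nat k \<cdot>\<^sub>m ((1 / of_nat k) \<cdot>\<^sub>m (transpose_mat V * V)) = transpose_mat V * V"
    using k by (intro eq_matI) simp_all
  ultimately have "transpose_mat V * V = of_nat k \<cdot>\<^sub>m 1\<^sub>m n"
    by metis
  also have "transpose_mat V * V = map_mat of_int (transpose_mat W * W)"
    unfolding VT unfolding V_def using C by (subst of_int_hom.mat_hom_mult[of _ n n _ n]) auto
  also have "of_nat k \<cdot>\<^sub>m 1\<^sub>m n = (map_mat of_int (int k \<cdot>\<^sub>m 1\<^sub>m n) :: rat mat)"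
    by (intro eq_matI) auto
  finally show ?thesis by (rule of_int_hom.mat_hom_inj)
qed

context
  fixes n k :: nat and W :: "int mat"
  assumes W: "weighing_matrix n k W"
begin

lemma weighing_matrix_entry:
  assumes "i < n" "j < n"
  shows "W $$ (i, j) \<in> {0, 1, -1}"
  using assms W elements_matI[of W n n i j "W $$ (i, j)"] by (auto simp: weighing_matrix_def)

lemma weighing_matrix_row_orthogonal:
  assumes "i < n" "j < n"
  shows "(\<Sum>p<n. W $$ (i, p) * W $$ (j, p)) = (if i = j then int k else 0)"
proof -
  have C: "W \<in> carrier_mat n n" and WW: "W * transpose_mat W = int k \<cdot>\<^sub>m 1\<^sub>m n"
    using W by (auto simp: weighing_matrix_def)
  have "(W * transpose_mat W) $$ (i, j) = (\<Sum>p<n. W $$ (i, p) * W $$ (j, p))"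
    using C assms by (auto simp: scalar_prod_def lessThan_atLeast0)
  with WW assms show ?thesis by (cases "i = j") auto
qed

lemma weighing_matrix_col_norm:
  assumes "k \<noteq> 0" "p < n"
  shows "(\<Sum>j<n. W $$ (j, p) ^ 2) = int k"
proof -
  have C: "W \<in> carrier_mat n n" using W by (auto simp: weighing_matrix_def)
  have "(transpose_mat W * W) $$ (p, p) = (\<Sum>j<n. W $$ (j, p) ^ 2)"
    using C assms by (auto simp: scalar_prod_def lessThan_atLeast0 power2_eq_square)
  with weighing_matrix_transpose_mult[OF W assms(1)] assms(2) show ?thesis by simp
qed

text \<open>For an entry \<open>w\<close> in {0, 1, -1}, \<open>1 - w ^ 2\<close> is the indicator
  of \<open>w = 0\<close>. Cardinalities thus become polynomial sums to which the orthogonality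
  relations apply.\<close>

lemma card_line_Int:
  assumes "i < n" "j < n"
  shows "int (card (line W i \<inter> line W j)) = (\<Sum>p<n. (1 - W $$ (i, p) ^ 2) * (1 - W $$ (j, p) ^ 2))"
proof -
  have "line W i \<inter> line W j = {p \<in> {..<n}. W $$ (i, p) = 0 \<and> W $$ (j, p) = 0}"
    using W by (auto simp: line_def weighing_matrix_def)
  hence "int (card (line W i \<inter> line W j)) =
      (\<Sum>p<n. if W $$ (i, p) = 0 \<and> W $$ (j, p) = 0 then 1 else 0)"
    by (simp add: sum.If_cases Int_def)
  also have "\<dots> = (\<Sum>p<n. (1 - W $$ (i, p) ^ 2) * (1 - W $$ (j, p) ^ 2))"
  proof (intro sum.cong refl)
    fix p assume "p \<in> {..<n}"
    thus "(if W $$ (i, p) = 0 \<and> W $$ (j, p) = 0 then 1 else 0) =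
        (1 - W $$ (i, p) ^ 2) * (1 - W $$ (j, p) ^ 2)"
      using weighing_matrix_entry[OF assms(1), of p] weighing_matrix_entry[OF assms(2), of p]
      by auto
  qed
  finally show ?thesis .
qed

lemma card_line:
  assumes "i < n"
  shows "int (card (line W i)) = int n - int k"
proof -
  have "int (card (line W i)) = (\<Sum>p<n. (1 - W $$ (i, p) ^ 2) * (1 - W $$ (i, p) ^ 2))"
    using card_line_Int[OF assms assms] by simp
  \<comment> \<open>The factor \<open>1 - w ^ 2\<close> takes only the values 0 and 1, so it is
    idempotent.\<close>
  also have "\<dots> = (\<Sum>p<n. 1 - W $$ (i, p) * W $$ (i, p))"
  proof (intro sum.cong refl)
    fix p assume "p \<in> {..<n}"
    thus "(1 - W $$ (i, p) ^ 2) * (1 - W $$ (i, p) ^ 2) = 1 - W $$ (i, p) * W $$ (i, p)"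
      using weighing_matrix_entry[OF assms, of p] by auto
  qed
  finally show ?thesis
    using weighing_matrix_row_orthogonal[OF assms assms] by (simp add: sum_subtractf)
qed

lemma even_card_line_Int:
  assumes i: "i < n" and j: "j < n" and ne: "i \<noteq> j"
  shows "even (card (line W i \<inter> line W j)) \<longleftrightarrow> even n"
proof -
  let ?x = "\<lambda>p. W $$ (i, p)" and ?y = "\<lambda>p. W $$ (j, p)"
  \<comment> \<open>The product term \<open>x ^ 2 * y ^ 2\<close> is split as
    \<open>x * y + (x * y) * (x * y - 1)\<close>: the first part sums to 0 by orthogonality, and the
    second is a product of consecutive integers, hence even. The two row norms contribute the even
    number \<open>2 * k\<close>.\<close>
  have "int (card (line W i \<inter> line W j)) =
      (\<Sum>p<n. 1 - ?x p * ?x p - ?y p * ?y p + ?x p * ?y p + (?x p * ?y p) * (?x p * ?y p - 1))"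
    unfolding card_line_Int[OF i j]
    by (intro sum.cong) (auto simp: algebra_simps power2_eq_square)
  also have "\<dots> = int n - 2 * int k + (\<Sum>p<n. (?x p * ?y p) * (?x p * ?y p - 1))"
    using weighing_matrix_row_orthogonal[OF i i] weighing_matrix_row_orthogonal[OF j j]
      weighing_matrix_row_orthogonal[OF i j] ne
    by (simp add: sum.distrib sum_subtractf)
  finally have eq: "int (card (line W i \<inter> line W j)) =
    int n - 2 * int k + (\<Sum>p<n. (?x p * ?y p) * (?x p * ?y p - 1))" .
  have "even (\<Sum>p<n. (?x p * ?y p) * (?x p * ?y p - 1))"
    by (intro dvd_sum) auto
  hence "even (int (card (line W i \<inter> line W j))) \<longleftrightarrow> even (int n)"
    unfolding eq by simp
  thus ?thesis by simp
qed

text \<open>Double counting of pairs \<open>(j, p)\<close> with \<open>p\<close> on both lines: each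
  of the \<open>n - k\<close> points of \<open>line W i\<close> lies on \<open>n - k\<close> lines,
  by the column norms. The term \<open>j = i\<close> is included, which gives a square.\<close>

lemma sum_card_line_Int:
  assumes k: "k \<noteq> 0" and i: "i < n"
  shows "(\<Sum>j<n. int (card (line W i \<inter> line W j))) = (int n - int k) ^ 2"
proof -
  have "(\<Sum>j<n. int (card (line W i \<inter> line W j))) =
      (\<Sum>j<n. \<Sum>p<n. (1 - W $$ (i, p) ^ 2) * (1 - W $$ (j, p) ^ 2))"
    using card_line_Int[OF i] by (intro sum.cong) auto
  also have "\<dots> = (\<Sum>p<n. (1 - W $$ (i, p) ^ 2) * (\<Sum>j<n. 1 - W $$ (j, p) ^ 2))"
    by (subst sum.swap) (simp add: sum_distrib_left)
  also have "\<dots> = (\<Sum>p<n. (1 - W $$ (i, p) ^ 2) * (int n - int k))"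
    using weighing_matrix_col_norm[OF k] by (intro sum.cong) (auto simp: sum_subtractf)
  also have "\<dots> = (\<Sum>p<n. 1 - W $$ (i, p) * W $$ (i, p)) * (int n - int k)"
    by (simp add: sum_distrib_right power2_eq_square)
  also have "\<dots> = (int n - int k) ^ 2"
    using weighing_matrix_row_orthogonal[OF i i] by (simp add: sum_subtractf power2_eq_square)
  finally show ?thesis .
qed

end

theorem proposition7:
  fixes W :: "int mat"
  assumes "weighing_matrix 23 16 W"
  shows "regular_weighted_graph (Gamma_tilde W) 10"
proof -
  have dim: "dim_row W = 23" using assms by (auto simp: weighing_matrix_def)
  let ?G = "Gamma_tilde W"
  let ?c = "\<lambda>i j. card (line W i \<inter> line W j)"
  have "weighted_graph ?G"
    unfolding weighted_graph_def
    by (auto simp: Gamma_tilde_def Let_def)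
  moreover have "wdegree ?G i = 10" if "i \<in> verts ?G" for i
  proof -
    from that dim have i: "i < 23" by (simp add: Gamma_tilde_def)
    \<comment> \<open>The neighbours of \<open>i\<close>; they correspond bijectively to the edges
      at \<open>i\<close>, so the degree becomes a sum over vertices.\<close>
    define J where "J = {j \<in> {..<23} - {i}. ?c i j \<in> {3, 5, 7}}"
    have edges: "{e \<in> edges ?G. i \<in> e} = (\<lambda>j. {i, j}) ` J"
      using i dim by (auto simp: Gamma_tilde_def J_def Int_commute insert_commute)
    have inj: "inj_on (\<lambda>j. {i, j}) J"
      by (auto simp: inj_on_def J_def doubleton_eq_iff)
    have card_i: "card (line W i) = 7"
      using card_line[OF assms i] by simp
    have cases: "?c i j \<in> {1, 3, 5, 7}" if "j \<in> {..<23} - {i}" for j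
    proof -
      have "finite (line W i)" by (simp add: line_def)
      hence "?c i j \<le> 7" using card_mono[of "line W i" "line W i \<inter> line W j"] card_i by simp
      hence "?c i j \<in> {0, 1, 2, 3, 4, 5, 6, 7}" by (simp only: insert_iff empty_iff) linarith
      moreover have "odd (?c i j)" using even_card_line_Int[OF assms i, of j] that by auto
      ultimately show ?thesis by (elim insertE emptyE) simp_all
    qed
    have "wdegree ?G i = (\<Sum>j\<in>J. weight ?G {i, j})"
      unfolding wdegree_def edges by (simp add: sum.reindex[OF inj] o_def)
    also have "\<dots> = (\<Sum>j\<in>J. (?c i j - 1) div 2)"
      by (intro sum.cong) (auto simp: Gamma_tilde_def J_def Let_def)
    \<comment> \<open>A vertex other than \<open>i\<close> outside \<open>J\<close> meets
      \<open>line W i\<close> in exactly one point, so it adds 0.\<close>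
    also have "\<dots> = (\<Sum>j\<in>{..<23} - {i}. (?c i j - 1) div 2)"
    proof (intro sum.mono_neutral_left ballI)
      fix j assume "j \<in> {..<23} - {i} - J"
      thus "(?c i j - 1) div 2 = 0"
        using cases[of j] by (auto simp: J_def)
    qed (auto simp: J_def)
    \<comment> \<open>Doubling removes the \<open>div\<close>, which is exact because the
      intersection sizes are odd; over the integers the subtraction is not truncated.\<close>
    finally have "2 * int (wdegree ?G i) = (\<Sum>j\<in>{..<23} - {i}. 2 * int ((?c i j - 1) div 2))"
      by (simp add: sum_distrib_left)
    also have "\<dots> = (\<Sum>j\<in>{..<23} - {i}. int (?c i j) - 1)"
    proof (intro sum.cong refl)
      fix j assume "j \<in> {..<23} - {i}"
      thus "2 * int ((?c i j - 1) div 2) = int (?c i j) - 1"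
        using cases[of j] by auto
    qed
    also have "\<dots> = (\<Sum>j<23. int (?c i j) - 1) - (int (?c i i) - 1)"
      using i by (subst sum_diff1) auto
    \<comment> \<open>The full sum is 49 - 23 = 26, and the diagonal term is 7 - 1 = 6.\<close>
    also have "\<dots> = 20"
      using sum_card_line_Int[OF assms _ i] card_i by (simp add: sum_subtractf)
    finally show ?thesis by simp
  qed
  ultimately show ?thesis by (simp add: regular_weighted_graph_def)
qed

end
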